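(* Let $\{P_\theta\}_{\theta\in\Theta}$ be a family of probability measures on a measurable space $(\Omega,\mathcal{F})$. Let $\Theta_0^1,\dots,\Theta_0^K$ be (not necessarily disjoint) null hypotheses, $\Theta_0=\bigcup_{j=1}^K\Theta_0^j$, and let $\Theta$ be partitioned into $\Theta_0$ and the alternative $\Theta_1$. Let $(E_1,\dots,E_K)$ be a compound e-variable for $\Theta_0^1,\dots,\Theta_0^K$. For $j=1,\dots,K$, let $S_j$ be a sufficient statistic for $\Theta_j:=\Theta_0^j\cup\Theta_1$ and define $G_j=\mathbb{E}_{\Theta_j}[E_j\mid S_j]$. Then $\mathbb{E}_\theta[f(G_j)]\ge\mathbb{E}_\theta[f(E_j)]$ for any $j$, any concave utility function $f$ and any $\theta\in\Theta_1\cup\Theta_0^j$, and $$\sum_{k:\,\theta\in\Theta_0^k\cup\Theta_1}\mathbb{E}_\theta[f(G_k)]\ \ge\ \sum_{k:\,\theta\in\Theta_0^k\cup\Theta_1}\mathbb{E}_\theta[f(E_k)]\quad\text{for all }\theta\in\Theta_0\cup\Theta_1,$$ assuming all expectations (and the sums of them) are well-defined. Moreover, $\mathbb{E}_\theta[\log(E_j/G_j)]\le 0$ for all $j$ and all $\theta\in\Theta_0^j\cup\Theta_1$.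
   Context: Random variables are measurable functions on $\Omega$ with values in $[-\infty,\infty]$; $\mathbb{E}_\theta$ denotes expectation under $P_\theta$. The expectation $\mathbb{E}[Y]$ is well-defined as an element of $[-\infty,\infty]$ if $\mathbb{E}[Y^+]$ or $\mathbb{E}[Y^-]$ is finite; generalized conditional expectations then exist (in particular for all $Y\ge 0$). A sum of extended reals is well-defined if it does not contain both $+\infty$ and $-\infty$. A compound e-variable for $\Theta_0^1,\dots,\Theta_0^K$ is a tuple $(E_1,\dots,E_K)$ of nonnegative ($[0,\infty]$-valued) random variables such that $\sum_{k:\theta\in\Theta_0^k}\mathbb{E}_\theta[E_k]\le K$ for all $\theta\in\Theta_0$. For a subset $\Theta'\subseteq\Theta$, a measurable function $S$ on $\Omega$ (with values in a measurable space) is a sufficient statistic for $\Theta'$ if for every random variable $h$ on $\Omega$ there is a measurable function $g_h$ such that $\mathbb{E}_\theta[h\mid S]=g_h(S)$ $P_\theta$-a.s. for all $\theta\in\Theta'$, whenever these conditional expectations exist (in particular whenever $h\ge 0$). The common version $g_h(S)$ is denoted $\mathbb{E}_{\Theta'}[h\mid S]$. A concave utility function is a concave function $f:(0,\infty)\to\mathbb{R}$, extended to $f:[0,\infty]\to[-\infty,\infty]$ by $f(0):=\lim_{x\downarrow 0}f(x)$ and $f(\infty):=\lim_{x\to\infty}f(x)$. Ratios use the conventions $0/0=0$ and $\infty/\infty=1$; also $\log 0=-\infty$, $\log\infty=\infty$. *)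

theory Defs
  imports "HOL-Probability.Probability"
begin

section \<open>Expectations and conditional expectations of extended-real random variables\<close>

definition expectation_defined :: "'a measure \<Rightarrow> ('a \<Rightarrow> ereal) \<Rightarrow> bool" where
  "expectation_defined Q Y \<longleftrightarrow>
     (\<integral>\<^sup>+ x. e2ennreal (Y x) \<partial>Q) < \<infinity> \<or> (\<integral>\<^sup>+ x. e2ennreal (- Y x) \<partial>Q) < \<infinity>"

text \<open>
  \<^term>\<open>e2ennreal\<close> sends negative values to \<open>0\<close>, so the two integrands are the positive and the
  negative part of \<open>Y\<close>.  The value is meaningful only under \<^const>\<open>expectation_defined\<close>
  (library convention: \<open>\<infinity> - \<infinity> = \<infinity>\<close>).
\<close>

definition ext_expectation :: "'a measure \<Rightarrow> ('a \<Rightarrow> ereal) \<Rightarrow> ereal" where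
  "ext_expectation Q Y =
     enn2ereal (\<integral>\<^sup>+ x. e2ennreal (Y x) \<partial>Q) - enn2ereal (\<integral>\<^sup>+ x. e2ennreal (- Y x) \<partial>Q)"

text \<open>
  The generalized conditional expectation, built from \<^const>\<open>nn_cond_exp\<close> in the same way as
  \<^const>\<open>real_cond_exp\<close> but keeping infinite values.  If \<^term>\<open>expectation_defined Q h\<close>, then
  \<open>\<infinity> - \<infinity>\<close> occurs only on a null set.
\<close>

definition ext_cond_exp :: "'a measure \<Rightarrow> 'a measure \<Rightarrow> ('a \<Rightarrow> ereal) \<Rightarrow> 'a \<Rightarrow> ereal" where
  "ext_cond_exp Q F h x =
     enn2ereal (nn_cond_exp Q F (\<lambda>y. e2ennreal (h y)) x)
     - enn2ereal (nn_cond_exp Q F (\<lambda>y. e2ennreal (- h y)) x)"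

definition sum_well_defined :: "'k set \<Rightarrow> ('k \<Rightarrow> ereal) \<Rightarrow> bool" where
  "sum_well_defined I a \<longleftrightarrow> \<not> ((\<exists>k\<in>I. a k = \<infinity>) \<and> (\<exists>l\<in>I. a l = - \<infinity>))"


section \<open>Sufficient statistics\<close>

text \<open>
  \<open>common_cond_exp P M T S N h g\<close>: the random variable \<open>g \<circ> S\<close> is a version of the conditional
  expectation of \<open>h\<close> given \<open>\<sigma>(S)\<close> under \<open>P \<theta>\<close>, for all \<open>\<theta> \<in> T\<close> for which it exists.  Here \<open>M\<close>
  is only used as a measurable space.
\<close>

definition common_cond_exp ::
  "('i \<Rightarrow> 'a measure) \<Rightarrow> 'a measure \<Rightarrow> 'i set \<Rightarrow> ('a \<Rightarrow> 's) \<Rightarrow> 's measure \<Rightarrow>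
   ('a \<Rightarrow> ereal) \<Rightarrow> ('s \<Rightarrow> ereal) \<Rightarrow> bool" where
  "common_cond_exp P M T S N h g \<longleftrightarrow>
     g \<in> borel_measurable N \<and>
     (\<forall>\<theta>\<in>T. expectation_defined (P \<theta>) h \<longrightarrow>
        (AE x in P \<theta>. ext_cond_exp (P \<theta>) (vimage_algebra (space M) S N) h x = g (S x)))"

definition sufficient_statistic ::
  "('i \<Rightarrow> 'a measure) \<Rightarrow> 'a measure \<Rightarrow> 'i set \<Rightarrow> ('a \<Rightarrow> 's) \<Rightarrow> 's measure \<Rightarrow> bool" where
  "sufficient_statistic P M T S N \<longleftrightarrow>
     S \<in> measurable M N \<and>
     (\<forall>h \<in> borel_measurable M. \<exists>g. common_cond_exp P M T S N h g)"


section \<open>Compound e-variables\<close>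

definition compound_e_variable ::
  "('i \<Rightarrow> 'a measure) \<Rightarrow> 'a measure \<Rightarrow> nat \<Rightarrow> (nat \<Rightarrow> 'i set) \<Rightarrow> (nat \<Rightarrow> 'a \<Rightarrow> ennreal) \<Rightarrow> bool" where
  "compound_e_variable P M K Null E \<longleftrightarrow>
     (\<forall>k\<in>{1..K}. E k \<in> borel_measurable M) \<and>
     (\<forall>\<theta> \<in> (\<Union>k\<in>{1..K}. Null k).
        (\<Sum>k\<in>{k \<in> {1..K}. \<theta> \<in> Null k}. \<integral>\<^sup>+ x. E k x \<partial>P \<theta>) \<le> of_nat K)"


section \<open>Concave utility functions, ratios and logarithms\<close>

definition concave_utility :: "(real \<Rightarrow> real) \<Rightarrow> bool" where
  "concave_utility f \<longleftrightarrow> concave_on {0<..} f"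

text \<open>For concave \<open>f\<close>, both limits exist in the extended reals.\<close>

definition utility_ext :: "(real \<Rightarrow> real) \<Rightarrow> ennreal \<Rightarrow> ereal" where
  "utility_ext f x =
     (if x = 0 then Lim (at_right 0) (\<lambda>t. ereal (f t))
      else if x = \<infinity> then Lim at_top (\<lambda>t. ereal (f t))
      else ereal (f (enn2real x)))"

text \<open>The library's division gives \<open>0 / 0 = 0\<close> but \<open>\<infinity> / \<infinity> = 0\<close>; here \<open>\<infinity> / \<infinity> = 1\<close>.\<close>

definition eratio :: "ennreal \<Rightarrow> ennreal \<Rightarrow> ennreal" where
  "eratio x y = (if x = \<infinity> \<and> y = \<infinity> then 1 else x / y)"

definition elog :: "ennreal \<Rightarrow> ereal" where
  "elog x = (if x = 0 then - \<infinity> else if x = \<infinity> then \<infinity> else ereal (ln (enn2real x)))"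

lemma eratio_simps [simp]:
  "eratio 0 y = 0"
  "eratio \<infinity> \<infinity> = 1"
  "x \<noteq> 0 \<Longrightarrow> eratio x 0 = \<infinity>"
  "x \<noteq> \<infinity> \<Longrightarrow> eratio x \<infinity> = 0"
  by (auto simp: eratio_def divide_ennreal_def ennreal_mult_top)


section \<open>Existence of nonnegative common versions\<close>

lemma sufficient_statistic_nonneg_version:
  fixes E :: "'a \<Rightarrow> ennreal"
  assumes P: "\<And>\<theta>. \<theta> \<in> T \<Longrightarrow> prob_space (P \<theta>) \<and> sets (P \<theta>) = sets M"
    and S: "sufficient_statistic P M T S N"
    and E: "E \<in> borel_measurable M"
  obtains g :: "'s \<Rightarrow> ennreal"
  where "common_cond_exp P M T S N (\<lambda>x. enn2ereal (E x)) (\<lambda>s. enn2ereal (g s))"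
proof -
  let ?F = "vimage_algebra (space M) S N"
  have Sm: "S \<in> measurable M N" using S by (simp add: sufficient_statistic_def)
  have "(\<lambda>x. enn2ereal (E x)) \<in> borel_measurable M" using E by measurable
  then obtain g where g: "common_cond_exp P M T S N (\<lambda>x. enn2ereal (E x)) g"
    using S by (auto simp: sufficient_statistic_def)
  have gm [measurable]: "g \<in> borel_measurable N" using g by (simp add: common_cond_exp_def)
  have "common_cond_exp P M T S N (\<lambda>x. enn2ereal (E x)) (\<lambda>s. enn2ereal (e2ennreal (g s)))"
    unfolding common_cond_exp_def
  proof (intro conjI ballI impI)
    show "(\<lambda>s. enn2ereal (e2ennreal (g s))) \<in> borel_measurable N" by measurable
    fix \<theta> assume \<theta>: "\<theta> \<in> T" and d: "expectation_defined (P \<theta>) (\<lambda>x. enn2ereal (E x))"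
    have sets: "sets (P \<theta>) = sets M" and sp: "space (P \<theta>) = space M"
      using P[OF \<theta>] sets_eq_imp_space_eq by auto
    interpret prob_space "P \<theta>" using P[OF \<theta>] by simp
    have sub: "subalgebra (P \<theta>) ?F"
      unfolding subalgebra_def using sp sets Sm
      by (auto simp: sets_vimage_algebra2 measurable_space measurable_sets Pi_iff)
    interpret finite_measure_subalgebra "P \<theta>" ?F by unfold_locales (rule sub)
    have neg: "e2ennreal (- enn2ereal c) = 0" for c by (simp add: e2ennreal_neg)
    have "AE x in P \<theta>. (0::ennreal) = nn_cond_exp (P \<theta>) ?F (\<lambda>_. 0) x"
      by (rule nn_cond_exp_F_meas) simp
    moreover have "AE x in P \<theta>. ext_cond_exp (P \<theta>) ?F (\<lambda>x. enn2ereal (E x)) x = g (S x)"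
      using g \<theta> d by (auto simp: common_cond_exp_def)
    ultimately show "AE x in P \<theta>. ext_cond_exp (P \<theta>) ?F (\<lambda>x. enn2ereal (E x)) x
        = enn2ereal (e2ennreal (g (S x)))"
    proof eventually_elim
      case (elim x)
      have "g (S x) = enn2ereal (nn_cond_exp (P \<theta>) ?F E x)"
        unfolding elim(2)[symmetric] ext_cond_exp_def using elim(1)
        by (simp add: neg zero_ennreal.rep_eq)
      then show ?case using elim(2) by simp
    qed
  qed
  then show ?thesis by (rule that)
qed

end

(* Under each P_theta, G_j is a version of the conditional expectation C of E_j given sigma(S_j), so
   everything is a conditional Jensen inequality for a [0,\<infinity>]-valued E that need not be integrable.
   Where C is finite, integrate the supergradient inequality f(E) <= f(C) + s(C)(E - C) over the
   sets {C < \<infinity>, |s(C)| C <= n}; all terms are first moved to the side where they are nonnegative, so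
   that the linear terms cancel by the defining property of C and monotone convergence gives n \<rightarrow> \<infinity>.
   Where C is infinite, either f(\<infinity>) is the supremum of f, or f lies below a decreasing affine
   function and the negative part of f(E) has infinite integral as soon as this set has positive
   measure.  The logarithmic claim follows by integrating 1 + log+ t <= t + log- t at t = E/C, since
   E/C has expectation at most 1. *)

theory Submission
  imports Defs "HOL-Real_Asymp.Real_Asymp"
begin

section \<open>Monotone limits and supergradients of concave functions\<close>

lemma mono_on_tendsto_at_right:
  fixes h :: "real \<Rightarrow> ereal"
  assumes "a < b" and h: "mono_on {a<..<b} h"
  shows "(h \<longlongrightarrow> (INF x\<in>{a<..<b}. h x)) (at_right a)"
proof (rule order_tendstoI)
  fix c assume c: "c < (INF x\<in>{a<..<b}. h x)"
  have "\<forall>\<^sub>F x in at_right a. x \<in> {a<..<b}"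
    using \<open>a < b\<close> by (rule eventually_at_right_real)
  then show "\<forall>\<^sub>F x in at_right a. c < h x"
    by (rule eventually_mono) (metis INF_lower c less_le_trans)
next
  fix c assume "(INF x\<in>{a<..<b}. h x) < c"
  then obtain y where y: "y \<in> {a<..<b}" "h y < c" by (auto simp: INF_less_iff)
  have "\<forall>\<^sub>F x in at_right a. x \<in> {a<..<y}"
    using y by (intro eventually_at_right_real) simp
  then show "\<forall>\<^sub>F x in at_right a. h x < c"
  proof (rule eventually_mono)
    fix x assume "x \<in> {a<..<y}"
    then have "h x \<le> h y" using y by (intro mono_onD[OF h]) auto
    then show "h x < c" using y by simp
  qed
qed

lemma mono_on_tendsto_at_top:
  fixes h :: "real \<Rightarrow> ereal"
  assumes h: "mono_on {a<..} h"
  shows "(h \<longlongrightarrow> (SUP x\<in>{a<..}. h x)) at_top"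
proof (rule order_tendstoI)
  fix c assume c: "(SUP x\<in>{a<..}. h x) < c"
  show "\<forall>\<^sub>F x in at_top. h x < c"
    using eventually_gt_at_top[of a]
    by (rule eventually_mono) (metis SUP_upper c greaterThan_iff le_less_trans)
next
  fix c assume "c < (SUP x\<in>{a<..}. h x)"
  then obtain y where y: "y \<in> {a<..}" "c < h y" by (auto simp: less_SUP_iff)
  show "\<forall>\<^sub>F x in at_top. c < h x"
    using eventually_gt_at_top[of y]
  proof (rule eventually_mono)
    fix x assume "y < x"
    then have "h y \<le> h x" using y by (intro mono_onD[OF h]) auto
    then show "c < h x" using y by simp
  qed
qed

text \<open>A single function selects a slope at every point at once, so that \<open>s\<close> can
  be evaluated at the conditional expectation and integrated.\<close>

definition supergradient :: "(real \<Rightarrow> real) \<Rightarrow> (real \<Rightarrow> real) \<Rightarrow> bool" where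
  "supergradient f s \<longleftrightarrow> (\<forall>x>0. \<forall>y>0. f x \<le> f y + s y * (x - y))"

lemma concave_utility_supergradient:
  assumes "concave_utility f"
  obtains s where "supergradient f s"
proof -
  have cvx: "convex_on {0<..} (\<lambda>x. - f x)"
    using assms by (simp add: concave_utility_def concave_on_def)
  \<comment> \<open>The infimum of the right difference quotients of the convex function
    \<open>- f\<close> is its right derivative, so \<open>s\<close> is the right derivative of
    \<open>f\<close>.\<close>
  define s where "s y = - Inf ((\<lambda>t. (- f y - - f t) / (y - t)) ` ({y<..} \<inter> {0<..}))" for y
  have "f x \<le> f y + s y * (x - y)" if "0 < x" "0 < y" for x y
    using convex_le_Inf_differential[OF cvx, of y x] that
    unfolding s_def by (simp add: interior_open)
  then show ?thesis by (auto intro!: that simp: supergradient_def)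
qed

text \<open>In the sum of the supergradient inequalities at the two points the values of
  \<open>f\<close> cancel. Measurability of \<open>s\<close> comes from this monotonicity.\<close>

lemma supergradient_antimono:
  assumes "supergradient f s" "0 < x" "x \<le> y"
  shows "s y \<le> s x"
proof (cases "x = y")
  case False
  have "f x \<le> f y + s y * (x - y)" "f y \<le> f x + s x * (y - x)"
    using assms by (auto simp: supergradient_def)
  then have "0 \<le> (s x - s y) * (y - x)" by (simp add: algebra_simps)
  then show ?thesis using assms False by (simp add: zero_le_mult_iff)
qed simp

lemma borel_measurable_if_mono_on:
  fixes h :: "real \<Rightarrow> real"
  assumes "mono_on {a<..} h"
  shows "(\<lambda>x. if a < x then h x else 0) \<in> borel_measurable borel"
proof -
  have "(\<lambda>x. indicator {a<..} x *\<^sub>R h x) \<in> borel_measurable borel"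
    using borel_measurable_mono_on_fnc[OF assms]
    by (subst (asm) borel_measurable_restrict_space_iff) auto
  also have "(\<lambda>x. indicator {a<..} x *\<^sub>R h x) = (\<lambda>x. if a < x then h x else 0)"
    by (auto simp: indicator_def)
  finally show ?thesis .
qed

text \<open>Concavity gives continuity on the open half-line only. Elsewhere \<open>f\<close> is
  arbitrary, hence the cut-off to 0.\<close>

lemma borel_measurable_concave:
  assumes "concave_utility f"
  shows "(\<lambda>x. if 0 < x then f x else 0) \<in> borel_measurable borel"
proof -
  have "continuous_on {0<..} (\<lambda>x. - f x)"
    using assms by (intro convex_on_continuous) (auto simp: concave_utility_def concave_on_def)
  then have "continuous_on {0<..} f"
    using continuous_on_minus by fastforce
  then have "(\<lambda>x. indicator {0<..} x *\<^sub>R f x) \<in> borel_measurable borel"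
    by (intro borel_measurable_continuous_on_indicator) auto
  also have "(\<lambda>x. indicator {0<..} x *\<^sub>R f x) = (\<lambda>x. if 0 < x then f x else 0)"
    by (auto simp: indicator_def)
  finally show ?thesis .
qed

lemma borel_measurable_supergradient:
  assumes "supergradient f s"
  shows "(\<lambda>y. if 0 < y then s y else 0) \<in> borel_measurable borel"
proof -
  have "mono_on {0<..} (\<lambda>x. - s x)"
    using supergradient_antimono[OF assms] by (auto intro!: mono_onI)
  then have "(\<lambda>y. - (if 0 < y then - s y else 0)) \<in> borel_measurable borel"
    by (intro borel_measurable_uminus borel_measurable_if_mono_on)
  also have "(\<lambda>y. - (if 0 < y then - s y else 0)) = (\<lambda>y. if 0 < y then s y else 0)"
    by auto
  finally show ?thesis .
qed

section \<open>The utility at zero and at infinity\<close>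

lemma borel_measurable_utility_ext:
  assumes "concave_utility f"
  shows "utility_ext f \<in> borel_measurable borel"
proof -
  note [measurable] = borel_measurable_concave[OF assms]
  have "utility_ext f = (\<lambda>x. if x = 0 then utility_ext f 0
      else if x = \<infinity> then utility_ext f \<infinity>
      else ereal (if 0 < enn2real x then f (enn2real x) else 0))"
    by (auto simp: fun_eq_iff utility_ext_def enn2real_positive_iff top.not_eq_extremum)
  also have "\<dots> \<in> borel_measurable borel"
    by measurable
  finally show ?thesis .
qed

text \<open>\<open>Lim\<close> is informative only once a limit is known to exist. Near 0 it does,
  by monotonicity: a slope \<open>s b \<ge> 0\<close> forces nonnegative slopes to the left of
  \<open>b\<close>, so \<open>f\<close> is nondecreasing there; otherwise all slopes are negative
  and \<open>f\<close> is decreasing.\<close>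

lemma utility_ext_0_tendsto:
  assumes s: "supergradient f s"
  shows "((\<lambda>t. ereal (f t)) \<longlongrightarrow> utility_ext f 0) (at_right 0)"
proof -
  have f: "f x \<le> f y + s y * (x - y)" if "0 < x" "0 < y" for x y
    using s that by (auto simp: supergradient_def)
  have "\<exists>l. ((\<lambda>t. ereal (f t)) \<longlongrightarrow> l) (at_right 0)"
  proof (cases "\<exists>b>0. s b \<ge> 0")
    case True
    then obtain b where b: "b > 0" "s b \<ge> 0" by blast
    have "mono_on {0<..<b} (\<lambda>t. ereal (f t))"
    proof (rule mono_onI)
      fix x y assume xy: "x \<in> {0<..<b}" "y \<in> {0<..<b}" "x \<le> y"
      have "s b \<le> s y" using xy by (intro supergradient_antimono[OF s]) auto
      then have "s y * (x - y) \<le> 0" using b xy by (intro mult_nonneg_nonpos) auto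
      then show "ereal (f x) \<le> ereal (f y)" using f[of x y] xy by simp
    qed
    then show ?thesis using mono_on_tendsto_at_right[OF b(1)] by blast
  next
    case False
    have "mono_on {0<..<1} (\<lambda>t. - ereal (f t))"
    proof (rule mono_onI)
      fix x y :: real assume xy: "x \<in> {0<..<1}" "y \<in> {0<..<1}" "x \<le> y"
      have "s x * (y - x) \<le> 0" using False xy by (intro mult_nonpos_nonneg) (auto simp: not_le less_imp_le)
      then show "- ereal (f x) \<le> - ereal (f y)" using f[of y x] xy by simp
    qed
    from mono_on_tendsto_at_right[OF _ this]
    have "((\<lambda>t. - (- ereal (f t))) \<longlongrightarrow> - (INF t\<in>{0<..<1}. - ereal (f t))) (at_right 0)"
      by (intro tendsto_uminus_ereal) auto
    then show ?thesis unfolding ereal_uminus_uminus by blast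
  qed
  then show ?thesis by (auto simp: utility_ext_def tendsto_Lim)
qed

lemma utility_ext_real: "0 < x \<Longrightarrow> utility_ext f (ennreal x) = ereal (f x)"
  by (simp add: utility_ext_def)

text \<open>At \<open>x = 0\<close> this is the limit of the inequality for positive arguments. In
  particular the utility at 0 is never \<open>\<infinity>\<close>, though it may be
  \<open>- \<infinity>\<close>.\<close>

lemma utility_ext_le_supergradient:
  assumes s: "supergradient f s" and "0 \<le> x" "0 < y"
  shows "utility_ext f (ennreal x) \<le> ereal (f y + s y * (x - y))"
proof (cases "x = 0")
  case True
  have "utility_ext f 0 \<le> ereal (f y + s y * (0 - y))"
  proof (rule tendsto_le[OF _ _ utility_ext_0_tendsto[OF s]])
    show "((\<lambda>t. ereal (f y + s y * (t - y))) \<longlongrightarrow> ereal (f y + s y * (0 - y))) (at_right 0)"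
      by (intro tendsto_intros)
    show "\<forall>\<^sub>F t in at_right 0. ereal (f t) \<le> ereal (f y + s y * (t - y))"
      using eventually_at_right_less[of "0::real"]
      by (rule eventually_mono) (use s \<open>0 < y\<close> in \<open>auto simp: supergradient_def\<close>)
  qed simp
  then show ?thesis using True by simp
qed (use assms in \<open>auto simp: utility_ext_real supergradient_def\<close>)

text \<open>Nonnegative slopes make \<open>f\<close> nondecreasing, so its limit at infinity is its
  supremum over the positive reals; the value at 0 is compared through \<open>f 1\<close>.\<close>

lemma utility_ext_le_top:
  assumes s: "supergradient f s" and nonneg: "\<And>y. 0 < y \<Longrightarrow> 0 \<le> s y"
  shows "utility_ext f x \<le> utility_ext f \<infinity>"
proof -
  have f: "f x \<le> f y + s y * (x - y)" if "0 < x" "0 < y" for x y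
    using s that by (auto simp: supergradient_def)
  have "mono_on {0<..} (\<lambda>t. ereal (f t))"
  proof (rule mono_onI)
    fix x y :: real assume xy: "x \<in> {0<..}" "y \<in> {0<..}" "x \<le> y"
    then have "s y * (x - y) \<le> 0" using nonneg by (intro mult_nonneg_nonpos) auto
    then show "ereal (f x) \<le> ereal (f y)" using f[of x y] xy by simp
  qed
  from mono_on_tendsto_at_top[OF this]
  have top: "utility_ext f \<infinity> = (SUP t\<in>{0<..}. ereal (f t))"
    by (simp add: utility_ext_def tendsto_Lim)
  have le: "ereal (f y) \<le> utility_ext f \<infinity>" if "0 < y" for y
    unfolding top using that by (intro SUP_upper) auto
  show ?thesis
  proof (cases x)
    case (real r)
    have "utility_ext f 0 \<le> ereal (f 1 + s 1 * (0 - 1))"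
      using utility_ext_le_supergradient[OF s, of 0 1] by simp
    also have "\<dots> \<le> ereal (f 1)" using nonneg[of 1] by simp
    finally have "utility_ext f 0 \<le> utility_ext f \<infinity>" using le[of 1] by (rule order_trans) simp
    then show ?thesis using real le[of r]
      by (cases "r = 0") (auto simp: utility_ext_real)
  qed simp
qed

lemma utility_ext_top_eq_MInfty:
  assumes s: "supergradient f s" and y: "0 < y" "s y < 0"
  shows "utility_ext f \<infinity> = - \<infinity>"
proof -
  have "filterlim (\<lambda>t. f y + s y * (t - y)) at_bot at_top"
    using y by real_asymp
  moreover have "\<forall>\<^sub>F t in at_top. f t \<le> f y + s y * (t - y)"
    using eventually_gt_at_top[of "0::real"]
    by (rule eventually_mono) (use s y in \<open>auto simp: supergradient_def\<close>)
  ultimately have "filterlim f at_bot at_top"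
    by (rule filterlim_at_bot_mono)
  then have "((\<lambda>t. ereal (f t)) \<longlongrightarrow> - \<infinity>) at_top"
    by (simp add: tendsto_MInfty filterlim_at_bot_dense)
  then show ?thesis by (simp add: utility_ext_def tendsto_Lim)
qed

text \<open>\<open>ennreal\<close> truncates at 0, so \<open>ennreal a\<close> and
  \<open>ennreal (- a)\<close> are the positive and negative parts of \<open>a\<close>. Adding the
  parts across turns a real inequality into one between nonnegative quantities that can be
  integrated without any integrability assumption.\<close>

lemma ennreal_parts_mono:
  fixes r w p q :: real
  assumes "r + q \<le> w + p"
  shows "ennreal r + ennreal (- w) + (ennreal (- p) + ennreal q)
    \<le> ennreal w + ennreal (- r) + (ennreal p + ennreal (- q))"
proof -
  have max: "ennreal a = ennreal (max 0 a)" for a by (simp add: ennreal_neg max_def)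
  have "ennreal (max 0 r + max 0 (- w) + (max 0 (- p) + max 0 q))
    \<le> ennreal (max 0 w + max 0 (- r) + (max 0 p + max 0 (- q)))"
    using assms by (intro ennreal_leI) linarith
  then show ?thesis
    by (subst (1 2 3 4 5 6 7 8) max) simp
qed

text \<open>The supergradient inequality, with every term moved to the side where it is nonnegative.\<close>

lemma e2ennreal_parts_supergradient_le:
  fixes s :: "real \<Rightarrow> real" and x y :: ennreal
  assumes s: "supergradient f s" and "x < \<infinity>" "y < \<infinity>" and "y = 0 \<Longrightarrow> x = 0"
  defines "\<sigma> \<equiv> if 0 < enn2real y then s (enn2real y) else 0"
  shows "e2ennreal (utility_ext f x) + e2ennreal (- utility_ext f y)
           + (ennreal (- \<sigma>) * x + ennreal \<sigma> * y)
       \<le> e2ennreal (utility_ext f y) + e2ennreal (- utility_ext f x)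
           + (ennreal \<sigma> * x + ennreal (- \<sigma>) * y)"
proof (cases "y = 0")
  case False
  obtain x' where x: "x = ennreal x'" "0 \<le> x'" using \<open>x < \<infinity>\<close> by (cases x) auto
  obtain y' where y: "y = ennreal y'" "0 < y'" using \<open>y < \<infinity>\<close> False
    by (cases y) (auto simp: less_le)
  have \<sigma>: "\<sigma> = s y'" using y by (simp add: \<sigma>_def)
  have le: "utility_ext f x \<le> ereal (f y' + \<sigma> * (x' - y'))"
    using utility_ext_le_supergradient[OF s x(2) y(2)] by (simp add: x \<sigma>)
  have mult: "ennreal \<sigma> * ennreal z = ennreal (\<sigma> * z)"
    "ennreal (- \<sigma>) * ennreal z = ennreal (- (\<sigma> * z))" if "0 \<le> z" for z
    using that ennreal_mult''[of z "- \<sigma>"] by (simp_all add: ennreal_mult'')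
  show ?thesis
  proof (cases "utility_ext f x")
    case (real r)
    have r: "r \<le> f y' + \<sigma> * (x' - y')" using le real by simp
    have fy: "utility_ext f y = ereal (f y')" using y by (simp add: utility_ext_real)
    show ?thesis
      unfolding real fy unfolding x(1) y(1)
      using ennreal_parts_mono[of r "\<sigma> * y'" "f y'" "\<sigma> * x'"] r
        mult[OF x(2)] mult[OF less_imp_le[OF y(2)]]
      by (simp add: algebra_simps)
  \<comment> \<open>The upper bound \<open>le\<close> excludes \<open>\<infinity>\<close>; at
    \<open>- \<infinity>\<close> the negative part on the right is infinite.\<close>
  qed (use le in auto)
\<comment> \<open>For \<open>y = 0\<close> also \<open>x = 0\<close>, and both linear terms vanish,
  so the two sides coincide.\<close>
qed (use assms in auto)

text \<open>Monotone convergence in the form of continuity from below of the measures with densities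
  \<open>u\<close> and \<open>v\<close>.\<close>

lemma set_nn_integral_le_UN:
  assumes D: "range D \<subseteq> sets M" "incseq D"
    and u: "u \<in> borel_measurable M" and v: "v \<in> borel_measurable M"
    and le: "\<And>n::nat. (\<integral>\<^sup>+x\<in>D n. u x \<partial>M) \<le> (\<integral>\<^sup>+x\<in>D n. v x \<partial>M)"
  shows "(\<integral>\<^sup>+x\<in>(\<Union>n. D n). u x \<partial>M) \<le> (\<integral>\<^sup>+x\<in>(\<Union>n. D n). v x \<partial>M)"
proof -
  have *: "(\<integral>\<^sup>+x\<in>(\<Union>n. D n). w x \<partial>M) = (SUP n. \<integral>\<^sup>+x\<in>D n. w x \<partial>M)"
    if "w \<in> borel_measurable M" for w
  proof -
    have "emeasure (density M w) (\<Union>n. D n) = (SUP n. emeasure (density M w) (D n))"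
      using D by (intro SUP_emeasure_incseq[symmetric]) auto
    then show ?thesis using that D
      by (subst (asm) (1 2) emeasure_density) auto
  qed
  show ?thesis unfolding *[OF u] *[OF v] by (intro SUP_mono' le)
qed

section \<open>Nonnegative conditional expectations and the conditional Jensen inequality\<close>

context finite_measure_subalgebra
begin

lemma set_nn_cond_exp_intg:
  assumes [measurable]: "A \<in> sets F" "h \<in> borel_measurable F" "E \<in> borel_measurable M"
  shows "(\<integral>\<^sup>+x\<in>A. h x * E x \<partial>M) = (\<integral>\<^sup>+x\<in>A. h x * nn_cond_exp M F E x \<partial>M)"
  using nn_cond_exp_intg[of "\<lambda>x. h x * indicator A x" E] by (simp add: mult_ac)

text \<open>The set where the conditional expectation vanishes lies in \<open>F\<close>, and
  \<open>E\<close> integrates to 0 over it. This provides the side condition of the supergradient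
  inequality at \<open>y = 0\<close>.\<close>

lemma AE_eq_0_if_nn_cond_exp_eq_0:
  assumes [measurable]: "E \<in> borel_measurable M"
  shows "AE x in M. nn_cond_exp M F E x = 0 \<longrightarrow> E x = 0"
proof -
  have "(\<integral>\<^sup>+x. indicator {0} (nn_cond_exp M F E x) * E x \<partial>M)
      = (\<integral>\<^sup>+x. indicator {0} (nn_cond_exp M F E x) * nn_cond_exp M F E x \<partial>M)"
    by (rule nn_cond_exp_intg[symmetric]) measurable
  also have "\<dots> = (\<integral>\<^sup>+x. 0 \<partial>M)" by (intro nn_integral_cong) (simp add: indicator_def)
  finally have "AE x in M. indicator {0} (nn_cond_exp M F E x) * E x = 0"
    by (subst nn_integral_0_iff_AE[symmetric]) auto
  then show ?thesis by eventually_elim (auto simp: indicator_def split: if_splits)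
qed

text \<open>Over the set where the conditional expectation is at most \<open>n\<close>, the integral
  of \<open>E\<close> is at most \<open>n\<close> times the finite total mass; countably many such
  sets suffice.\<close>

lemma AE_finite_if_nn_cond_exp_finite:
  assumes [measurable]: "E \<in> borel_measurable M"
  shows "AE x in M. nn_cond_exp M F E x < \<infinity> \<longrightarrow> E x < \<infinity>"
proof -
  have "AE x in M. nn_cond_exp M F E x \<le> of_nat n \<longrightarrow> E x < \<infinity>" for n
  proof -
    have "(\<integral>\<^sup>+x. indicator {..of_nat n} (nn_cond_exp M F E x) * E x \<partial>M)
        = (\<integral>\<^sup>+x. indicator {..of_nat n} (nn_cond_exp M F E x) * nn_cond_exp M F E x \<partial>M)"
      by (rule nn_cond_exp_intg[symmetric]) measurable
    also have "\<dots> \<le> (\<integral>\<^sup>+x. of_nat n \<partial>M)"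
      by (intro nn_integral_mono) (simp add: indicator_def)
    also have "\<dots> < \<infinity>"
      using emeasure_finite[of "space M"] by (auto simp: less_top[symmetric] ennreal_mult_eq_top_iff)
    finally have "AE x in M. indicator {..of_nat n} (nn_cond_exp M F E x) * E x \<noteq> \<infinity>"
      by (intro nn_integral_PInf_AE) auto
    then show ?thesis by eventually_elim (auto simp: indicator_def less_top split: if_splits)
  qed
  then have "AE x in M. \<forall>n. nn_cond_exp M F E x \<le> of_nat n \<longrightarrow> E x < \<infinity>"
    unfolding AE_all_countable by blast
  then show ?thesis
    by eventually_elim (use ennreal_Ex_less_of_nat in \<open>fastforce intro: less_imp_le\<close>)
qed

text \<open>Neither expectation is assumed to be defined, so the comparison of the utilities of
  \<open>E\<close> and \<open>C\<close> is stated with the negative parts moved across.\<close>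

lemma utility_parts_nn_cond_exp_finite:
  assumes f: "concave_utility f" and s: "supergradient f s"
    and [measurable]: "E \<in> borel_measurable M"
  defines "C \<equiv> nn_cond_exp M F E"
  defines "D \<equiv> {x \<in> space M. C x < \<infinity>}"
  shows "(\<integral>\<^sup>+x\<in>D. e2ennreal (utility_ext f (E x)) + e2ennreal (- utility_ext f (C x)) \<partial>M)
       \<le> (\<integral>\<^sup>+x\<in>D. e2ennreal (utility_ext f (C x)) + e2ennreal (- utility_ext f (E x)) \<partial>M)"
proof -
  note [measurable] = borel_measurable_utility_ext[OF f] borel_measurable_supergradient[OF s]
  have [measurable]: "C \<in> borel_measurable F" "C \<in> borel_measurable M" by (auto simp: C_def)
  have space: "space F = space M" and sets: "sets F \<subseteq> sets M"
    using subalg by (auto simp: subalgebra_def)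
  define t where "t y = (if 0 < y then s y else 0)" for y
  have [measurable]: "t \<in> borel_measurable borel"
    using borel_measurable_supergradient[OF s] by (simp add: t_def[abs_def])
  \<comment> \<open>\<open>b\<close> dominates both linear terms in \<open>C\<close>. It is
    \<open>F\<close>-measurable, so its sublevel sets \<open>A n\<close> lie in \<open>F\<close>,
    and on each of them the linear terms have finite integral.\<close>
  define b where "b x = ennreal \<bar>t (enn2real (C x))\<bar> * C x" for x
  have [measurable]: "b \<in> borel_measurable F" by (simp add: b_def[abs_def])
  define A where "A n = {x \<in> space F. C x < \<infinity> \<and> b x \<le> of_nat n}" for n :: nat
  have A_F [measurable]: "A n \<in> sets F" for n by (simp add: A_def)
  have A_M [measurable]: "A n \<in> sets M" for n using A_F sets by blast
  have D: "D = (\<Union>n. A n)"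
  proof -
    have "\<exists>n::nat. b x \<le> of_nat n" if "C x < \<infinity>" for x
    proof -
      have "b x < \<infinity>" using that by (simp add: b_def ennreal_mult_less_top)
      then show ?thesis using ennreal_Ex_less_of_nat by (fastforce intro: less_imp_le)
    qed
    then show ?thesis by (auto simp: D_def A_def space)
  qed
  show ?thesis
    unfolding D
  proof (rule set_nn_integral_le_UN)
    show "incseq A" by (auto simp: incseq_def A_def intro: order_trans)
    fix n
    let ?p = "\<lambda>x. ennreal (t (enn2real (C x)))" and ?m = "\<lambda>x. ennreal (- t (enn2real (C x)))"
    let ?u = "\<lambda>x. e2ennreal (utility_ext f (E x)) + e2ennreal (- utility_ext f (C x))"
    let ?v = "\<lambda>x. e2ennreal (utility_ext f (C x)) + e2ennreal (- utility_ext f (E x))"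
    let ?c = "\<integral>\<^sup>+x\<in>A n. ?m x * C x \<partial>M" and ?d = "\<integral>\<^sup>+x\<in>A n. ?p x * C x \<partial>M"
    \<comment> \<open>With \<open>E\<close> replaced by \<open>C\<close>, the linear terms on either
      side of the supergradient inequality integrate to the same value
      \<open>?c + ?d\<close>.\<close>
    have E: "(\<integral>\<^sup>+x\<in>A n. ?m x * E x \<partial>M) = ?c" "(\<integral>\<^sup>+x\<in>A n. ?p x * E x \<partial>M) = ?d"
      unfolding C_def by (rule set_nn_cond_exp_intg; measurable)+
    have fin: "(\<integral>\<^sup>+x\<in>A n. h x * C x \<partial>M) < \<infinity>"
      if "\<And>x. h x \<le> ennreal \<bar>t (enn2real (C x))\<bar>" for h
    proof -
      have "(\<integral>\<^sup>+x\<in>A n. h x * C x \<partial>M) \<le> (\<integral>\<^sup>+x. of_nat n \<partial>M)"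
      proof (intro nn_integral_mono)
        fix x
        have "h x * C x \<le> b x" unfolding b_def using that by (intro mult_right_mono) auto
        then show "h x * C x * indicator (A n) x \<le> of_nat n"
          by (auto simp: A_def indicator_def intro: order_trans)
      qed
      also have "\<dots> < \<infinity>"
        using emeasure_finite[of "space M"] by (auto simp: less_top[symmetric] ennreal_mult_eq_top_iff)
      finally show ?thesis .
    qed
    have fin_cd: "?c < \<infinity>" "?d < \<infinity>" by (intro fin ennreal_leI; simp)+
    have "(\<integral>\<^sup>+x\<in>A n. ?u x \<partial>M) + (?c + ?d)
        = (\<integral>\<^sup>+x\<in>A n. ?u x + (?m x * E x + ?p x * C x) \<partial>M)"
      by (simp add: nn_integral_add distrib_right E)
    also have "\<dots> \<le> (\<integral>\<^sup>+x\<in>A n. ?v x + (?p x * E x + ?m x * C x) \<partial>M)"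
    proof (rule nn_integral_mono_AE)
      show "AE x in M. (?u x + (?m x * E x + ?p x * C x)) * indicator (A n) x
          \<le> (?v x + (?p x * E x + ?m x * C x)) * indicator (A n) x"
        using AE_eq_0_if_nn_cond_exp_eq_0[OF assms(3)] AE_finite_if_nn_cond_exp_finite[OF assms(3)]
      proof eventually_elim
        case (elim x)
        show ?case
        proof (cases "x \<in> A n")
          case True
          then have "C x < \<infinity>" by (simp add: A_def)
          with elim show ?thesis
            using e2ennreal_parts_supergradient_le[OF s, of "E x" "C x"]
            by (intro mult_right_mono) (auto simp: C_def t_def)
        qed simp
      qed
    qed
    also have "\<dots> = (\<integral>\<^sup>+x\<in>A n. ?v x \<partial>M) + (?d + ?c)"
      by (simp add: nn_integral_add distrib_right E)
    finally show "(\<integral>\<^sup>+x\<in>A n. ?u x \<partial>M) \<le> (\<integral>\<^sup>+x\<in>A n. ?v x \<partial>M)"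
      \<comment> \<open>Cancellation in \<open>ennreal\<close> requires the common summand
        \<open>?c + ?d\<close> to be finite; this is the purpose of truncating to
        \<open>A n\<close>.\<close>
      using fin_cd
      by (simp only: add.commute[of ?d] add.commute[of _ "?c + ?d"] ennreal_add_left_cancel_le) auto
  qed (use A_M in \<open>auto\<close>)
qed

lemma utility_parts_nn_cond_exp_infinite:
  assumes f: "concave_utility f" and s: "supergradient f s"
    and [measurable]: "E \<in> borel_measurable M"
  defines "C \<equiv> nn_cond_exp M F E"
  defines "D \<equiv> {x \<in> space M. C x = \<infinity>}"
  shows "(\<integral>\<^sup>+x\<in>D. e2ennreal (utility_ext f (E x)) + e2ennreal (- utility_ext f (C x)) \<partial>M)
       \<le> (\<integral>\<^sup>+x\<in>D. e2ennreal (utility_ext f (C x)) + e2ennreal (- utility_ext f (E x)) \<partial>M)"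
proof (cases "\<forall>y>0. 0 \<le> s y")
  case True
  show ?thesis
  proof (rule nn_integral_mono)
    fix x
    have le: "utility_ext f (E x) \<le> utility_ext f \<infinity>"
      using True by (intro utility_ext_le_top[OF s]) auto
    show "(e2ennreal (utility_ext f (E x)) + e2ennreal (- utility_ext f (C x))) * indicator D x
      \<le> (e2ennreal (utility_ext f (C x)) + e2ennreal (- utility_ext f (E x))) * indicator D x"
      using le by (auto simp: D_def indicator_def intro!: add_mono e2ennreal_mono)
  qed
next
  case False
  then obtain y where y: "0 < y" "s y < 0" by (auto simp: not_le)
  note [measurable] = borel_measurable_utility_ext[OF f]
  have [measurable]: "C \<in> borel_measurable F" "C \<in> borel_measurable M" by (auto simp: C_def)
  have space: "space F = space M" using subalg by (auto simp: subalgebra_def)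
  have D_F [measurable]: "D \<in> sets F" unfolding D_def space[symmetric] by measurable
  have D_M [measurable]: "D \<in> sets M" unfolding D_def by measurable
  have top: "utility_ext f \<infinity> = - \<infinity>" by (rule utility_ext_top_eq_MInfty[OF s y])
  show ?thesis
  proof (cases "emeasure M D = 0")
    case True
    then have "AE x in M. x \<notin> D" by (intro AE_not_in) auto
    then show ?thesis
      by (intro nn_integral_mono_AE) (auto elim!: eventually_mono)
  next
    case False
    let ?c = "ennreal (f y - s y * y)"
    \<comment> \<open>The supergradient inequality at \<open>y\<close>, solved for the linear term
      with positive coefficient \<open>- s y\<close>: an infinite integral of \<open>E\<close>
      forces an infinite negative part of its utility. Truncating the constant \<open>?c\<close> at
      0 only enlarges the right side.\<close>
    have affine: "ennreal (- s y) * x \<le> e2ennreal (- utility_ext f x) + ?c" for x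
    proof (cases x)
      case (real r)
      have le: "utility_ext f x \<le> ereal (f y + s y * (r - y))"
        using utility_ext_le_supergradient[OF s real(1) y(1)] real by simp
      show ?thesis
      proof (cases "utility_ext f x")
        case u: (real q)
        have "- s y * r \<le> - q + (f y - s y * y)" using le u by (simp add: algebra_simps)
        also have "ennreal \<dots> \<le> ennreal (- q) + ?c"
          by (cases "0 \<le> - q"; cases "0 \<le> f y - s y * y")
             (auto simp: ennreal_plus[symmetric] ennreal_neg intro!: ennreal_leI simp del: ennreal_plus)
        finally show ?thesis
          using u real y by (simp add: ennreal_mult[symmetric] ennreal_leI)
      qed (use le in auto)
    qed (use top in simp)
    \<comment> \<open>Here \<open>C\<close> is infinite on a set of positive measure. Below,
      \<open>?c\<close> contributes only a finite amount, so the negative part must account for the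
      infinite value.\<close>
    have "\<infinity> = (\<integral>\<^sup>+x\<in>D. ennreal (- s y) * C x \<partial>M)"
    proof -
      have "(\<integral>\<^sup>+x\<in>D. ennreal (- s y) * C x \<partial>M) = (\<integral>\<^sup>+x. \<infinity> * indicator D x \<partial>M)"
        using y by (intro nn_integral_cong) (auto simp: D_def indicator_def ennreal_mult_top)
      also have "\<dots> = \<infinity>" using False by (subst nn_integral_cmult_indicator) (auto simp: ennreal_top_mult)
      finally show ?thesis by simp
    qed
    also have "\<dots> = (\<integral>\<^sup>+x\<in>D. ennreal (- s y) * E x \<partial>M)"
      unfolding C_def by (rule set_nn_cond_exp_intg[symmetric]) auto
    also have "\<dots> \<le> (\<integral>\<^sup>+x\<in>D. e2ennreal (- utility_ext f (E x)) + ?c \<partial>M)"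
      by (intro nn_integral_mono mult_right_mono affine) auto
    also have "\<dots> = (\<integral>\<^sup>+x\<in>D. e2ennreal (- utility_ext f (E x)) \<partial>M) + ?c * emeasure M D"
      unfolding distrib_right by (subst nn_integral_add) (auto simp: nn_integral_cmult_indicator)
    finally have "(\<integral>\<^sup>+x\<in>D. e2ennreal (- utility_ext f (E x)) \<partial>M) = \<infinity>"
      by (simp add: top_unique ennreal_mult_eq_top_iff)
    moreover have "(\<integral>\<^sup>+x\<in>D. e2ennreal (- utility_ext f (E x)) \<partial>M)
        \<le> (\<integral>\<^sup>+x\<in>D. e2ennreal (utility_ext f (C x)) + e2ennreal (- utility_ext f (E x)) \<partial>M)"
      by (intro nn_integral_mono mult_right_mono) auto
    ultimately show ?thesis by (simp add: top_unique)
  qed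
qed

lemma utility_parts_nn_cond_exp:
  assumes f: "concave_utility f" and [measurable]: "E \<in> borel_measurable M"
  defines "C \<equiv> nn_cond_exp M F E"
  shows "(\<integral>\<^sup>+x. e2ennreal (utility_ext f (E x)) \<partial>M) + (\<integral>\<^sup>+x. e2ennreal (- utility_ext f (C x)) \<partial>M)
       \<le> (\<integral>\<^sup>+x. e2ennreal (utility_ext f (C x)) \<partial>M) + (\<integral>\<^sup>+x. e2ennreal (- utility_ext f (E x)) \<partial>M)"
proof -
  note [measurable] = borel_measurable_utility_ext[OF f]
  have [measurable]: "C \<in> borel_measurable M" by (simp add: C_def)
  obtain s where s: "supergradient f s" using concave_utility_supergradient[OF f] .
  let ?D = "{x \<in> space M. C x < \<infinity>}" and ?D' = "{x \<in> space M. C x = \<infinity>}"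
  have split: "(\<integral>\<^sup>+x. w x \<partial>M) = (\<integral>\<^sup>+x\<in>?D. w x \<partial>M) + (\<integral>\<^sup>+x\<in>?D'. w x \<partial>M)"
    if [measurable]: "w \<in> borel_measurable M" for w
  proof -
    have "(\<integral>\<^sup>+x. w x \<partial>M) = (\<integral>\<^sup>+x\<in>?D \<union> ?D'. w x \<partial>M)"
      by (intro nn_integral_cong) (auto simp: indicator_def less_top)
    also have "\<dots> = (\<integral>\<^sup>+x\<in>?D. w x \<partial>M) + (\<integral>\<^sup>+x\<in>?D'. w x \<partial>M)"
      by (intro nn_integral_disjoint_pair) auto
    finally show ?thesis .
  qed
  have "(\<integral>\<^sup>+x. e2ennreal (utility_ext f (E x)) + e2ennreal (- utility_ext f (C x)) \<partial>M)
     \<le> (\<integral>\<^sup>+x. e2ennreal (utility_ext f (C x)) + e2ennreal (- utility_ext f (E x)) \<partial>M)"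
    unfolding C_def
    by (subst (1 2) split[unfolded C_def], measurable)
       (intro add_mono utility_parts_nn_cond_exp_finite[OF f s] utility_parts_nn_cond_exp_infinite[OF f s] assms)
  then show ?thesis by (simp add: nn_integral_add)
qed

end

section \<open>Logarithms and ratios\<close>

lemma borel_measurable_elog [measurable]: "elog \<in> borel_measurable borel"
  unfolding elog_def[abs_def] by measurable

lemma borel_measurable_eratio [measurable]:
  assumes [measurable]: "f \<in> borel_measurable M" "g \<in> borel_measurable M"
  shows "(\<lambda>x. eratio (f x) (g x)) \<in> borel_measurable M"
  unfolding eratio_def by measurable

text \<open>For positive real \<open>t\<close> this is \<open>ln r \<le> r - 1\<close> in terms of
  parts; at 0 the negative part of the logarithm is infinite, and at infinity \<open>t\<close>
  itself is. The second bound keeps the positive part integrable when \<open>t\<close> is.\<close>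

lemma
  shows elog_parts_le: "1 + e2ennreal (elog t) \<le> t + e2ennreal (- elog t)"
    and elog_le: "e2ennreal (elog t) \<le> t"
proof -
  have "1 + e2ennreal (elog t) \<le> t + e2ennreal (- elog t) \<and> e2ennreal (elog t) \<le> t"
  proof (cases t)
    case (real r)
    show ?thesis
    proof (cases "r = 0")
      case False
      then have r: "0 < r" using real by simp
      have ln: "ln r \<le> r - 1" using r by (rule ln_le_minus_one)
      have "1 + ennreal (ln r) \<le> ennreal r + ennreal (- ln r)"
        using ennreal_parts_mono[of "ln r" 1 0 r] ln r by (simp add: ennreal_neg add.commute)
      moreover have "ennreal (ln r) \<le> ennreal r" using ln by (intro ennreal_leI) simp
      ultimately show ?thesis using real r by (simp add: elog_def)
    qed (simp add: real elog_def e2ennreal_neg)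
  qed (simp add: elog_def)
  then show "1 + e2ennreal (elog t) \<le> t + e2ennreal (- elog t)" "e2ennreal (elog t) \<le> t"
    by auto
qed

section \<open>Extended expectations of the utility and of the log-ratio\<close>

lemma expectation_defined_cong_AE:
  assumes "AE x in Q. X x = Y x"
  shows "expectation_defined Q X \<longleftrightarrow> expectation_defined Q Y"
proof -
  have "(\<integral>\<^sup>+x. e2ennreal (X x) \<partial>Q) = (\<integral>\<^sup>+x. e2ennreal (Y x) \<partial>Q)"
    "(\<integral>\<^sup>+x. e2ennreal (- X x) \<partial>Q) = (\<integral>\<^sup>+x. e2ennreal (- Y x) \<partial>Q)"
    using assms by (auto intro!: nn_integral_cong_AE)
  then show ?thesis by (simp add: expectation_defined_def)
qed

lemma ext_expectation_cong_AE:
  assumes "AE x in Q. X x = Y x"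
  shows "ext_expectation Q X = ext_expectation Q Y"
proof -
  have "(\<integral>\<^sup>+x. e2ennreal (X x) \<partial>Q) = (\<integral>\<^sup>+x. e2ennreal (Y x) \<partial>Q)"
    "(\<integral>\<^sup>+x. e2ennreal (- X x) \<partial>Q) = (\<integral>\<^sup>+x. e2ennreal (- Y x) \<partial>Q)"
    using assms by (auto intro!: nn_integral_cong_AE)
  then show ?thesis by (simp add: ext_expectation_def)
qed

text \<open>This leads back from parts moved across to differences. The finiteness assumptions have
  the shape of \<open>expectation_defined\<close> and exclude
  \<open>\<infinity> - \<infinity>\<close>.\<close>

lemma ennreal_diff_le_diff:
  fixes a a' b b' :: ennreal
  assumes "a < \<infinity> \<or> a' < \<infinity>" "b < \<infinity> \<or> b' < \<infinity>" "a + b' \<le> b + a'"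
  shows "enn2ereal a - enn2ereal a' \<le> enn2ereal b - enn2ereal b'"
  using assms
  by (cases a; cases a'; cases b; cases b')
     (auto simp: ennreal_plus[symmetric] top_unique simp del: ennreal_plus)

context finite_measure_subalgebra
begin

lemma ext_expectation_utility_nn_cond_exp:
  assumes "concave_utility f" "E \<in> borel_measurable M"
    and "expectation_defined M (\<lambda>x. utility_ext f (E x))"
    and "expectation_defined M (\<lambda>x. utility_ext f (nn_cond_exp M F E x))"
  shows "ext_expectation M (\<lambda>x. utility_ext f (E x))
    \<le> ext_expectation M (\<lambda>x. utility_ext f (nn_cond_exp M F E x))"
  unfolding ext_expectation_def
  using assms(3,4) utility_parts_nn_cond_exp[OF assms(1,2)]
  by (intro ennreal_diff_le_diff) (auto simp: expectation_defined_def)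

text \<open>Where the conditional expectation is positive and finite, the ratio has conditional
  expectation 1. Where it is 0 the ratio vanishes almost everywhere, and where it is infinite the
  conventions give a ratio of 0 or 1.\<close>

lemma nn_integral_eratio_nn_cond_exp_le:
  assumes [measurable]: "E \<in> borel_measurable M"
  shows "(\<integral>\<^sup>+x. eratio (E x) (nn_cond_exp M F E x) \<partial>M) \<le> emeasure M (space M)"
proof -
  define C where "C = nn_cond_exp M F E"
  have [measurable]: "C \<in> borel_measurable F" "C \<in> borel_measurable M" by (auto simp: C_def)
  \<comment> \<open>The reciprocal of \<open>C\<close>, cut off at 0 and infinity, is an
    \<open>F\<close>-measurable weight, so \<open>E\<close> may be replaced by \<open>C\<close>
    under it.\<close>
  let ?h = "\<lambda>x. inverse (C x) * indicator (- {0, \<infinity>}) (C x)"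
  have "(\<integral>\<^sup>+x. eratio (E x) (C x) \<partial>M) \<le> (\<integral>\<^sup>+x. ?h x * E x + indicator {\<infinity>} (C x) \<partial>M)"
  proof (rule nn_integral_mono_AE)
    show "AE x in M. eratio (E x) (C x) \<le> ?h x * E x + indicator {\<infinity>} (C x)"
      using AE_eq_0_if_nn_cond_exp_eq_0[OF assms]
      by eventually_elim
        (auto simp: C_def eratio_def indicator_def divide_ennreal_def mult.commute)
  qed
  also have "\<dots> = (\<integral>\<^sup>+x. ?h x * C x \<partial>M) + (\<integral>\<^sup>+x. indicator {\<infinity>} (C x) \<partial>M)"
    using nn_cond_exp_intg[of ?h E] by (simp add: nn_integral_add C_def)
  also have "\<dots> = (\<integral>\<^sup>+x. ?h x * C x + indicator {\<infinity>} (C x) \<partial>M)"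
    by (rule nn_integral_add[symmetric]) measurable
  also have "\<dots> \<le> (\<integral>\<^sup>+x. 1 \<partial>M)"
    by (intro nn_integral_mono)
       (auto simp: indicator_def ennreal_divide_self[unfolded divide_ennreal_def] mult.commute[of "inverse _"] less_top)
  finally show ?thesis by (simp add: C_def)
qed

end

lemma ext_expectation_elog_eratio_nn_cond_exp:
  assumes "prob_space M" "finite_measure_subalgebra M F" and [measurable]: "E \<in> borel_measurable M"
  defines "L \<equiv> \<lambda>x. elog (eratio (E x) (nn_cond_exp M F E x))"
  shows "expectation_defined M L" "ext_expectation M L \<le> 0"
proof -
  interpret prob_space M by fact
  interpret finite_measure_subalgebra M F by fact
  let ?R = "\<lambda>x. eratio (E x) (nn_cond_exp M F E x)"
  let ?a = "\<integral>\<^sup>+x. e2ennreal (L x) \<partial>M" and ?b = "\<integral>\<^sup>+x. e2ennreal (- L x) \<partial>M"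
  have [measurable]: "L \<in> borel_measurable M" unfolding L_def by measurable
  have R: "(\<integral>\<^sup>+x. ?R x \<partial>M) \<le> 1"
    using nn_integral_eratio_nn_cond_exp_le[of E] by (simp add: emeasure_space_1)
  have "?a \<le> (\<integral>\<^sup>+x. ?R x \<partial>M)" unfolding L_def by (intro nn_integral_mono elog_le)
  also note R
  finally have a: "?a < \<infinity>" by (rule le_less_trans) simp
  then show "expectation_defined M L" by (simp add: expectation_defined_def)
  have "1 + ?a = (\<integral>\<^sup>+x. 1 + e2ennreal (L x) \<partial>M)"
    by (simp add: nn_integral_add emeasure_space_1)
  also have "\<dots> \<le> (\<integral>\<^sup>+x. ?R x + e2ennreal (- L x) \<partial>M)"
    unfolding L_def by (intro nn_integral_mono elog_parts_le)
  also have "\<dots> = (\<integral>\<^sup>+x. ?R x \<partial>M) + ?b"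
    by (rule nn_integral_add) measurable
  also have "\<dots> \<le> 1 + ?b" using R by (rule add_right_mono)
  finally have "?a \<le> ?b" by simp
  \<comment> \<open>As \<open>?a\<close> is finite, the difference is meaningful and nonpositive
    even when \<open>?b\<close> is infinite.\<close>
  then show "ext_expectation M L \<le> 0"
    using ennreal_diff_le_diff[of ?a ?b 0 0] a by (simp add: ext_expectation_def zero_ennreal.rep_eq)
qed

text \<open>A nonnegative variable always has a defined expectation, so the common version is valid
  under every \<theta> in \<open>T\<close>. This is the only route by which sufficiency enters the
  inequalities.\<close>

lemma common_cond_exp_nn_cond_exp:
  fixes E :: "'a \<Rightarrow> ennreal" and g :: "'s \<Rightarrow> ennreal"
  assumes P: "prob_space (P \<theta>)" "sets (P \<theta>) = sets M" and "\<theta> \<in> T" and S: "S \<in> measurable M N"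
    and g: "common_cond_exp P M T S N (\<lambda>x. enn2ereal (E x)) (\<lambda>s. enn2ereal (g s))"
  defines "F \<equiv> vimage_algebra (space M) S N"
  shows "finite_measure_subalgebra (P \<theta>) F"
    and "AE x in P \<theta>. g (S x) = nn_cond_exp (P \<theta>) F E x"
proof -
  have space: "space (P \<theta>) = space M" using P by (rule_tac sets_eq_imp_space_eq) simp
  interpret prob_space "P \<theta>" by fact
  have "subalgebra (P \<theta>) F"
    unfolding subalgebra_def F_def using space P S
    by (auto simp: sets_vimage_algebra2 measurable_space measurable_sets Pi_iff)
  then interpret finite_measure_subalgebra "P \<theta>" F by unfold_locales
  show "finite_measure_subalgebra (P \<theta>) F" by unfold_locales
  have neg: "e2ennreal (- enn2ereal c) = 0" for c by (simp add: e2ennreal_neg)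
  \<comment> \<open>The term subtracted in \<open>ext_cond_exp\<close> is a conditional expectation
    of the zero function, hence zero almost everywhere.\<close>
  have "AE x in P \<theta>. (0::ennreal) = nn_cond_exp (P \<theta>) F (\<lambda>_. 0) x"
    by (rule nn_cond_exp_F_meas) simp
  moreover have "AE x in P \<theta>. ext_cond_exp (P \<theta>) F (\<lambda>x. enn2ereal (E x)) x = enn2ereal (g (S x))"
    using g \<open>\<theta> \<in> T\<close> unfolding F_def by (auto simp: common_cond_exp_def expectation_defined_def neg)
  ultimately show "AE x in P \<theta>. g (S x) = nn_cond_exp (P \<theta>) F E x"
    by eventually_elim (simp add: ext_cond_exp_def neg zero_ennreal.rep_eq enn2ereal_inject)
qed

theorem corollary2p12:
  fixes M :: "'a measure"
    and P :: "'i \<Rightarrow> 'a measure"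
    and \<Theta> \<Theta>\<^sub>1 :: "'i set"
    and K :: nat
    and \<Theta>\<^sub>0 :: "nat \<Rightarrow> 'i set"
    and E G :: "nat \<Rightarrow> 'a \<Rightarrow> ennreal"
    and N :: "nat \<Rightarrow> 's measure"
    and S :: "nat \<Rightarrow> 'a \<Rightarrow> 's"
    and g :: "nat \<Rightarrow> 's \<Rightarrow> ennreal"
  assumes family: "\<And>\<theta>. \<theta> \<in> \<Theta> \<Longrightarrow> prob_space (P \<theta>) \<and> sets (P \<theta>) = sets M"
    and cover: "\<Theta> = (\<Union>j\<in>{1..K}. \<Theta>\<^sub>0 j) \<union> \<Theta>\<^sub>1"
    and disjoint: "(\<Union>j\<in>{1..K}. \<Theta>\<^sub>0 j) \<inter> \<Theta>\<^sub>1 = {}"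
    and e_var: "compound_e_variable P M K \<Theta>\<^sub>0 E"
    and suff: "\<And>j. j \<in> {1..K} \<Longrightarrow> sufficient_statistic P M (\<Theta>\<^sub>0 j \<union> \<Theta>\<^sub>1) (S j) (N j)"
    and version: "\<And>j. j \<in> {1..K} \<Longrightarrow>
          common_cond_exp P M (\<Theta>\<^sub>0 j \<union> \<Theta>\<^sub>1) (S j) (N j)
            (\<lambda>x. enn2ereal (E j x)) (\<lambda>s. enn2ereal (g j s))"
    and G_eq: "\<And>j x. G j x = g j (S j x)"
  shows "(\<forall>j\<in>{1..K}. \<forall>f. concave_utility f \<longrightarrow> (\<forall>\<theta> \<in> \<Theta>\<^sub>1 \<union> \<Theta>\<^sub>0 j.
            expectation_defined (P \<theta>) (\<lambda>x. utility_ext f (G j x)) \<longrightarrow>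
            expectation_defined (P \<theta>) (\<lambda>x. utility_ext f (E j x)) \<longrightarrow>
            ext_expectation (P \<theta>) (\<lambda>x. utility_ext f (G j x))
              \<ge> ext_expectation (P \<theta>) (\<lambda>x. utility_ext f (E j x))))
       \<and> (\<forall>f. concave_utility f \<longrightarrow> (\<forall>\<theta> \<in> (\<Union>j\<in>{1..K}. \<Theta>\<^sub>0 j) \<union> \<Theta>\<^sub>1.
            let I = {k \<in> {1..K}. \<theta> \<in> \<Theta>\<^sub>0 k \<union> \<Theta>\<^sub>1} in
            (\<forall>k\<in>I. expectation_defined (P \<theta>) (\<lambda>x. utility_ext f (G k x))
                 \<and> expectation_defined (P \<theta>) (\<lambda>x. utility_ext f (E k x))) \<longrightarrow>
            sum_well_defined I (\<lambda>k. ext_expectation (P \<theta>) (\<lambda>x. utility_ext f (G k x))) \<longrightarrow>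
            sum_well_defined I (\<lambda>k. ext_expectation (P \<theta>) (\<lambda>x. utility_ext f (E k x))) \<longrightarrow>
            (\<Sum>k\<in>I. ext_expectation (P \<theta>) (\<lambda>x. utility_ext f (G k x)))
              \<ge> (\<Sum>k\<in>I. ext_expectation (P \<theta>) (\<lambda>x. utility_ext f (E k x)))))
       \<and> (\<forall>j\<in>{1..K}. \<forall>\<theta> \<in> \<Theta>\<^sub>0 j \<union> \<Theta>\<^sub>1.
            expectation_defined (P \<theta>) (\<lambda>x. elog (eratio (E j x) (G j x)))
          \<and> ext_expectation (P \<theta>) (\<lambda>x. elog (eratio (E j x) (G j x))) \<le> 0)"
proof -
  let ?F = "\<lambda>j. vimage_algebra (space M) (S j) (N j)"
  let ?C = "\<lambda>\<theta> j. nn_cond_exp (P \<theta>) (?F j) (E j)"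
  have basic: "prob_space (P \<theta>)" "E j \<in> borel_measurable (P \<theta>)"
      "finite_measure_subalgebra (P \<theta>) (?F j)" "AE x in P \<theta>. G j x = ?C \<theta> j x"
    if j: "j \<in> {1..K}" and \<theta>: "\<theta> \<in> \<Theta>\<^sub>0 j \<union> \<Theta>\<^sub>1" for j \<theta>
  proof -
    have "\<theta> \<in> \<Theta>" using that by (auto simp: cover)
    then have P: "prob_space (P \<theta>)" "sets (P \<theta>) = sets M" using family by auto
    have "E j \<in> borel_measurable M" using e_var j by (auto simp: compound_e_variable_def)
    then show "prob_space (P \<theta>)" "E j \<in> borel_measurable (P \<theta>)"
      using P by (auto cong: measurable_cong_sets)
    have S: "S j \<in> measurable M (N j)" using suff[OF j] by (simp add: sufficient_statistic_def)
    show "finite_measure_subalgebra (P \<theta>) (?F j)" "AE x in P \<theta>. G j x = ?C \<theta> j x"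
      unfolding G_eq by (rule common_cond_exp_nn_cond_exp[OF P \<theta> S version[OF j]])+
  qed
  have utility: "ext_expectation (P \<theta>) (\<lambda>x. utility_ext f (E j x))
      \<le> ext_expectation (P \<theta>) (\<lambda>x. utility_ext f (G j x))"
    if j: "j \<in> {1..K}" and \<theta>: "\<theta> \<in> \<Theta>\<^sub>0 j \<union> \<Theta>\<^sub>1" and f: "concave_utility f"
      and G: "expectation_defined (P \<theta>) (\<lambda>x. utility_ext f (G j x))"
      and E: "expectation_defined (P \<theta>) (\<lambda>x. utility_ext f (E j x))" for j \<theta> f
  proof -
    interpret finite_measure_subalgebra "P \<theta>" "?F j" using basic(3)[OF j \<theta>] .
    have AE: "AE x in P \<theta>. utility_ext f (G j x) = utility_ext f (?C \<theta> j x)"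
      using basic(4)[OF j \<theta>] by eventually_elim simp
    show ?thesis
      using ext_expectation_utility_nn_cond_exp[OF f basic(2)[OF j \<theta>] E] G
      unfolding expectation_defined_cong_AE[OF AE] ext_expectation_cong_AE[OF AE] .
  qed
  have log: "expectation_defined (P \<theta>) (\<lambda>x. elog (eratio (E j x) (G j x)))
      \<and> ext_expectation (P \<theta>) (\<lambda>x. elog (eratio (E j x) (G j x))) \<le> 0"
    if j: "j \<in> {1..K}" and \<theta>: "\<theta> \<in> \<Theta>\<^sub>0 j \<union> \<Theta>\<^sub>1" for j \<theta>
  proof -
    have AE: "AE x in P \<theta>. elog (eratio (E j x) (G j x)) = elog (eratio (E j x) (?C \<theta> j x))"
      using basic(4)[OF j \<theta>] by eventually_elim simp
    show ?thesis
      unfolding expectation_defined_cong_AE[OF AE] ext_expectation_cong_AE[OF AE]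
      using ext_expectation_elog_eratio_nn_cond_exp[OF basic(1,3,2)[OF j \<theta>]] by blast
  qed
  show ?thesis
    \<comment> \<open>The inequality between sums holds term by term, since each index in the sum
      satisfies the condition of \<open>utility\<close>.\<close>
    unfolding Let_def using log by (auto intro!: utility sum_mono)
qed

end
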